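(* Let $(G,l,A,\sigma)$ be a labelled graph with multiplicity on $n$ vertices and let $1,k$ be two distinct vertices of $G$ with $\{1,k\}\notin E_G$. Suppose the collapse of $1$ and $k$ is simple. Then there exist a (nonempty) finite number of matrices $C_{1\equiv k}$ such that $$\mathcal{A}_G\,C_{1\equiv k}=\mathcal{A}_{G_{1\equiv k}}.$$ If $\mathcal{A}_G$ is written in block form $(F,N)$, where $F$ (resp. $N$) is the matrix of the exponents of the images of the feasible (resp. non-feasible) variables, then $C_{1\equiv k}$ is a $2^{n-1}\times2^{n-2}$ matrix of the block form $$C_{1\equiv k}=\begin{pmatrix}\operatorname{id}\\0\end{pmatrix}.$$
   Context: Graphs are finite and simple, $G=(V_G;E_G)$ with $|V_G|=n$. Partitions. For a finite nonempty set $V$, $\Pi_V$ is the set of unordered pairs $A|B$ with $A\cup B=V$, $A\cap B=\emptyset$ (one of $A,B$ may be empty; $A|B=B|A$). $Cut_G(A|B)$ is the set of edges of $G$ with one endpoint in $A$ and the other in $B$. Labelled graphs with multiplicity. A labeling is a surjective map $l:E_G\to A$ onto a set $A$ of labels. A multiplicity map is a map $\sigma:E_G\to\mathbb{Z}\setminus\{0\}$. Then $(G,l,A,\sigma)$ is a labelled graph with multiplicity. The matrix $\mathcal{A}$. The toric map $\phi_{(G,l,A,\sigma)}$ sends the variable $r_p$ ($p\in\Pi_{V_G}$) to $\prod_{e\in Cut_G(p)}s_{l(e)}^{\sigma(e)}\prod_{e\in E_G\setminus Cut_G(p)}t_{l(e)}^{\sigma(e)}$ in variables $s_a,t_a$ ($a\in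 A$). $\mathcal{A}_G=\mathcal{A}_{(G,l,A,\sigma)}$ is the integer matrix with rows indexed by the $s_a$ and $t_a$, $a\in A$, and columns indexed by $\Pi_{V_G}$ (in some chosen order), the column of $p$ being the exponent vector of the image of $r_p$. Collapse. Let $\{1,k\}\notin E_G$. The collapsed graph $G_{1\equiv k}$ has vertex set $V_G\setminus\{k\}$ and edge set $E'$ obtained from $E_G$ by replacing each edge $\{i,k\}$ by $\{i,1\}$, keeping only one copy of repeated edges. The collapse is simple if $|E_G|=|E'|$, i.e. no vertex is adjacent to both $1$ and $k$; in that case the edges of $G_{1\equiv k}$ correspond bijectively to those of $G$, and $G_{1\equiv k}$ carries the label set, labels and multiplicities transported along this bijection (so the rows of $\mathcal{A}_{G_{1\equiv k}}$ and $\mathcal{A}_G$ are indexed by the same set). Feasibility. A partition $A|B\in\Pi_{V_G}$ is feasible if $1$ and $k$ lie both in $A$ or both in $B$; the variable $r_{A|B}$ is then feasible, otherwise non-feasible. For $p\in\Pi_{V_G\setminus\{k\}}$, $p_f\in\Pi_{V_G}$ is the feasible partition obtained by adding $k$ to the part of $p$ containing $1$; $p\mapsto p_f$ is a bijection onto the feasible partitions. In the block form, the columns of $F$ are ordered so that $p_f$ is in the position of $p$ in the chosen order of the columns of $\mathcal{A}_{G_{1\equiv k}}$. *)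

theory Defs
  imports "Jordan_Normal_Form.Matrix"
begin

text \<open>A labelled graph with multiplicity: a finite simple graph whose edges are two-element sets
  of vertices, with a labelling \<open>l\<close> of the edges onto \<open>A\<close> and nonzero integer multiplicities \<open>\<sigma>\<close>.
  Only the values of \<open>l\<close> and \<open>\<sigma>\<close> on edges matter.\<close>

definition labelled_graph ::
  "'v set \<Rightarrow> 'v set set \<Rightarrow> ('v set \<Rightarrow> 'a) \<Rightarrow> 'a set \<Rightarrow> ('v set \<Rightarrow> int) \<Rightarrow> bool" where
  "labelled_graph V E l A \<sigma> \<longleftrightarrow>
     finite V \<and> V \<noteq> {} \<and> (\<forall>e\<in>E. e \<subseteq> V \<and> card e = 2) \<and> l ` E = A \<and> (\<forall>e\<in>E. \<sigma> e \<noteq> 0)"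

text \<open>The unordered pair \<open>X|Y\<close> is the set \<open>{X, Y}\<close>; one part may be empty.\<close>

definition partitions :: "'v set \<Rightarrow> 'v set set set" where
  "partitions V = {{X, Y} | X Y. X \<union> Y = V \<and> X \<inter> Y = {}}"

definition cut :: "'v set set \<Rightarrow> 'v set set \<Rightarrow> 'v set set" where
  "cut E p = {e \<in> E. \<exists>X Y. p = {X, Y} \<and> (\<exists>x\<in>X. \<exists>y\<in>Y. e = {x, y})}"

text \<open>The variables \<open>s\<^sub>a\<close>, \<open>t\<^sub>a\<close> of the target Laurent polynomial ring, which index the rows.\<close>

datatype 'a toric_var = S 'a | T 'a

text \<open>The exponent of a variable in the image
  \<open>(\<Prod>e \<in> cut E p. s\<^bsub>l(e)\<^esub> ^ \<sigma>(e)) * (\<Prod>e \<in> E - cut E p. t\<^bsub>l(e)\<^esub> ^ \<sigma>(e))\<close>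
  of \<open>r\<^sub>p\<close> under the toric map.\<close>

fun toric_exponent ::
  "'v set set \<Rightarrow> ('v set \<Rightarrow> 'a) \<Rightarrow> ('v set \<Rightarrow> int) \<Rightarrow> 'v set set \<Rightarrow> 'a toric_var \<Rightarrow> int" where
  "toric_exponent E l \<sigma> p (S a) = (\<Sum>e \<in> {e \<in> cut E p. l e = a}. \<sigma> e)"
| "toric_exponent E l \<sigma> p (T a) = (\<Sum>e \<in> {e \<in> E - cut E p. l e = a}. \<sigma> e)"

text \<open>An ordering of a finite index set is a list without repetitions.\<close>

definition ordering_of :: "'b list \<Rightarrow> 'b set \<Rightarrow> bool" where
  "ordering_of xs X \<longleftrightarrow> distinct xs \<and> set xs = X"

text \<open>The exponent matrix with rows ordered by \<open>rs\<close> and columns ordered by \<open>ps\<close>.\<close>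

definition toric_mat ::
  "'v set set \<Rightarrow> ('v set \<Rightarrow> 'a) \<Rightarrow> ('v set \<Rightarrow> int) \<Rightarrow> 'a toric_var list \<Rightarrow> 'v set set list \<Rightarrow> int mat" where
  "toric_mat E l \<sigma> rs ps =
     mat (length rs) (length ps) (\<lambda>(i, j). toric_exponent E l \<sigma> (ps ! j) (rs ! i))"

lemma toric_mat_append:
  "toric_mat E l \<sigma> rs (fs @ ns) =
     four_block_mat (toric_mat E l \<sigma> rs fs) (toric_mat E l \<sigma> rs ns)
       (0\<^sub>m 0 (length fs)) (0\<^sub>m 0 (length ns))"
  by (rule eq_matI) (auto simp: toric_mat_def nth_append)

definition collapse_edge :: "'v \<Rightarrow> 'v \<Rightarrow> 'v set \<Rightarrow> 'v set" where
  "collapse_edge u k e = (\<lambda>x. if x = k then u else x) ` e"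

definition collapse_edges :: "'v \<Rightarrow> 'v \<Rightarrow> 'v set set \<Rightarrow> 'v set set" where
  "collapse_edges u k E = collapse_edge u k ` E"

definition simple_collapse :: "'v \<Rightarrow> 'v \<Rightarrow> 'v set set \<Rightarrow> bool" where
  "simple_collapse u k E \<longleftrightarrow> card E = card (collapse_edges u k E)"

text \<open>Transport of a map on the edges of \<open>G\<close> to the edges of the collapsed graph; meaningful
  for simple collapses, where \<open>collapse_edge u k\<close> is injective on \<open>E\<close>.\<close>

definition collapse_map :: "'v \<Rightarrow> 'v \<Rightarrow> 'v set set \<Rightarrow> ('v set \<Rightarrow> 'b) \<Rightarrow> 'v set \<Rightarrow> 'b" where
  "collapse_map u k E f e' = f (inv_into E (collapse_edge u k) e')"

definition feasible :: "'v \<Rightarrow> 'v \<Rightarrow> 'v set set \<Rightarrow> bool" where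
  "feasible u k p \<longleftrightarrow> (\<exists>X\<in>p. u \<in> X \<and> k \<in> X)"

text \<open>The partition \<open>p\<^sub>f\<close>: \<open>k\<close> is added to the part of \<open>p\<close> containing \<open>u\<close>.\<close>

definition feasible_ext :: "'v \<Rightarrow> 'v \<Rightarrow> 'v set set \<Rightarrow> 'v set set" where
  "feasible_ext u k p = (\<lambda>X. if u \<in> X then insert k X else X) ` p"

end

theory Submission
  imports Defs
begin

text \<open>Under the simple collapse, an edge \<open>e\<close> of \<open>G\<close> is cut by the feasible extension
  \<open>p\<^sub>f\<close> exactly when its image is cut by \<open>p\<close>, because the vertex map sending \<open>k\<close> to \<open>u\<close> pulls
  the parts of \<open>p\<close> back to those of \<open>p\<^sub>f\<close>. Hence the column of \<open>p\<close> in the collapsed matrix is the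
  column of \<open>p\<^sub>f\<close> in the original one, and the 0-1 matrix selecting these columns does the job.\<close>

text \<open>Exactly one part of an unordered pair avoids \<open>u\<close>, so that part is a
  canonical representative. This replaces unordered pairs by subsets of \<open>V - {u}\<close>,
  which are easy to count.\<close>

lemma partitions_containing:
  assumes "u \<in> V"
  shows "partitions V = (\<lambda>Y. {V - Y, Y}) ` Pow (V - {u})"
proof (intro equalityI subsetI)
  fix p assume "p \<in> partitions V"
  then obtain X Y where p: "p = {X, Y}" and XY: "X \<union> Y = V" "X \<inter> Y = {}"
    unfolding partitions_def by blast
  show "p \<in> (\<lambda>Y. {V - Y, Y}) ` Pow (V - {u})"
  proof (cases "u \<in> X")
    case True
    with XY have "X = V - Y" "Y \<in> Pow (V - {u})" by auto
    with p show ?thesis by blast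
  next
    case False
    with XY have "Y = V - X" "X \<in> Pow (V - {u})" by auto
    with p show ?thesis by (simp add: insert_commute)
  qed
next
  fix p assume "p \<in> (\<lambda>Y. {V - Y, Y}) ` Pow (V - {u})"
  then obtain Y where "p = {V - Y, Y}" "Y \<subseteq> V" by blast
  then show "p \<in> partitions V" unfolding partitions_def by blast
qed

lemma card_partitions:
  assumes "finite V" "u \<in> V"
  shows "card (partitions V) = 2 ^ (card V - 1)"
proof -
  \<comment> \<open>Two such pairs cannot agree with their parts swapped: \<open>Y = V - Z\<close>
    would put \<open>u\<close> into \<open>Y\<close>.\<close>
  have "inj_on (\<lambda>Y. {V - Y, Y}) (Pow (V - {u}))"
    using assms(2) by (auto simp: inj_on_def doubleton_eq_iff)
  then show ?thesis
    using assms by (simp add: partitions_containing card_image card_Pow)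
qed

lemma partitionsE_containing:
  assumes "p \<in> partitions V" "u \<in> V"
  obtains X Y where "p = {X, Y}" "X \<union> Y = V" "X \<inter> Y = {}" "u \<in> X"
proof -
  from assms obtain Y where "p = {V - Y, Y}" "Y \<subseteq> V - {u}"
    by (auto simp: partitions_containing)
  with assms(2) show thesis by (intro that[of "V - Y" Y]) auto
qed

text \<open>This trades the existential over representations of the pair for a condition on
  intersections, which behaves well under preimages. The bound \<open>card e \<le> 2\<close>,
  instead of equality, is what is directly available for the image of an edge under the
  collapse.\<close>

lemma mem_cut_iff:
  assumes "X \<inter> Y = {}" "card e \<le> 2" "finite e"
  shows "e \<in> cut E {X, Y} \<longleftrightarrow> e \<in> E \<and> e \<inter> X \<noteq> {} \<and> e \<inter> Y \<noteq> {}"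
proof
  assume "e \<in> cut E {X, Y}"
  then show "e \<in> E \<and> e \<inter> X \<noteq> {} \<and> e \<inter> Y \<noteq> {}"
    unfolding cut_def by (auto simp: doubleton_eq_iff)
next
  assume e: "e \<in> E \<and> e \<inter> X \<noteq> {} \<and> e \<inter> Y \<noteq> {}"
  then obtain x y where xy: "x \<in> X" "y \<in> Y" "x \<in> e" "y \<in> e" by blast
  with assms(1) have "x \<noteq> y" by blast
  then have "card {x, y} = 2" by simp
  with xy assms(2,3) have "e = {x, y}"
    by (metis card_seteq empty_subsetI insert_subset)
  with e xy show "e \<in> cut E {X, Y}" unfolding cut_def by blast
qed

lemma feasible_ext_insert:
  assumes "u \<in> X" "X \<inter> Y = {}"
  shows "feasible_ext u k {X, Y} = {insert k X, Y}"
  using assms by (auto simp: feasible_ext_def)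

lemma feasible_ext_in_partitions:
  assumes "u \<in> V" "k \<in> V" "u \<noteq> k" "q \<in> partitions (V - {k})"
  shows "feasible_ext u k q \<in> partitions V"
proof -
  have "u \<in> V - {k}" using assms(1,3) by simp
  from assms(4) this
  obtain X Y where "q = {X, Y}" "X \<union> Y = V - {k}" "X \<inter> Y = {}" "u \<in> X"
    by (rule partitionsE_containing)
  moreover from this have "insert k X \<union> Y = V" "insert k X \<inter> Y = {}"
    using assms(2) by auto
  ultimately have "feasible_ext u k q = {insert k X, Y}" by (simp add: feasible_ext_insert)
  with \<open>insert k X \<union> Y = V\<close> \<open>insert k X \<inter> Y = {}\<close> show ?thesis
    unfolding partitions_def by blast
qed

lemma collapse_edge_in_cut_iff:
  assumes "e \<in> E" "e \<subseteq> V" "card e = 2" "u \<in> V" "u \<noteq> k" "q \<in> partitions (V - {k})"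
  shows "collapse_edge u k e \<in> cut (collapse_edges u k E) q
    \<longleftrightarrow> e \<in> cut E (feasible_ext u k q)"
proof -
  have "u \<in> V - {k}" using assms(4,5) by simp
  from assms(6) this
  obtain X Y where q: "q = {X, Y}" "X \<union> Y = V - {k}" "X \<inter> Y = {}" "u \<in> X"
    by (rule partitionsE_containing)
  have fin: "finite e" using assms(3) by (metis card.infinite zero_neq_numeral)
  then have "card (collapse_edge u k e) \<le> 2"
    using assms(3) unfolding collapse_edge_def by (metis card_image_le)
  moreover have "finite (collapse_edge u k e)"
    using fin by (simp add: collapse_edge_def)
  ultimately have "collapse_edge u k e \<in> cut (collapse_edges u k E) {X, Y}
      \<longleftrightarrow> collapse_edge u k e \<inter> X \<noteq> {} \<and> collapse_edge u k e \<inter> Y \<noteq> {}"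
    using q assms(1) by (simp add: mem_cut_iff collapse_edges_def)
  also have "\<dots> \<longleftrightarrow> e \<inter> insert k X \<noteq> {} \<and> e \<inter> Y \<noteq> {}"
  proof -
    \<comment> \<open>As \<open>u\<close> lies in \<open>X\<close>, the vertex map sends
      \<open>k\<close> into \<open>X\<close>.\<close>
    have "collapse_edge u k e \<inter> X \<noteq> {} \<longleftrightarrow> e \<inter> insert k X \<noteq> {}"
      using q(4) by (auto simp: collapse_edge_def split: if_splits)
    \<comment> \<open>\<open>Y\<close> contains neither \<open>u\<close> nor \<open>k\<close>, the
      only vertices that the map can affect.\<close>
    moreover have "collapse_edge u k e \<inter> Y \<noteq> {} \<longleftrightarrow> e \<inter> Y \<noteq> {}"
      using q(2-4) by (auto simp: collapse_edge_def split: if_splits)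
    ultimately show ?thesis by simp
  qed
  also have "\<dots> \<longleftrightarrow> e \<in> cut E {insert k X, Y}"
    using q assms(1,3) fin by (subst mem_cut_iff) auto
  finally show ?thesis using q by (simp add: feasible_ext_insert)
qed

text \<open>Injectivity makes the collapse a bijection of edge sets that carries labels,
  multiplicities and cuts along, so both exponents are the same sum up to reindexing.\<close>

lemma toric_exponent_collapse:
  fixes E :: "'v set set"
  assumes "\<forall>e\<in>E. e \<subseteq> V \<and> card e = 2" "inj_on (collapse_edge u k) E"
    "u \<in> V" "u \<noteq> k" "q \<in> partitions (V - {k})"
  shows "toric_exponent (collapse_edges u k E) (collapse_map u k E l) (collapse_map u k E \<sigma>) q v
    = toric_exponent E l \<sigma> (feasible_ext u k q) v"
proof -
  let ?c = "collapse_edge u k" and ?E = "collapse_edges u k E" and ?p = "feasible_ext u k q"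
  let ?l = "collapse_map u k E l" and ?\<sigma> = "collapse_map u k E \<sigma>"
  have l_eq: "?l (?c e) = l e" and \<sigma>_eq: "?\<sigma> (?c e) = \<sigma> e" if "e \<in> E" for e
    using that assms(2) by (simp_all add: collapse_map_def)
  have cut_iff: "?c e \<in> cut ?E q \<longleftrightarrow> e \<in> cut E ?p" if "e \<in> E" for e
    using that assms by (intro collapse_edge_in_cut_iff) auto
  have cut_subset: "cut F p \<subseteq> F" for F :: "'v set set" and p
    by (auto simp: cut_def)
  \<comment> \<open>Arbitrary predicates let one reindexing serve both the \<open>S\<close> rows,
    which sum over cut edges, and the \<open>T\<close> rows, which sum over the others.\<close>
  have reindex: "(\<Sum>e' \<in> {e' \<in> ?E. P e'}. ?\<sigma> e') = (\<Sum>e \<in> {e \<in> E. Q e}. \<sigma> e)"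
    if PQ: "\<And>e. e \<in> E \<Longrightarrow> P (?c e) \<longleftrightarrow> Q e" for P Q
  proof -
    have "{e' \<in> ?E. P e'} = ?c ` {e \<in> E. Q e}"
      using PQ by (auto simp: collapse_edges_def)
    moreover have "inj_on ?c {e \<in> E. Q e}" using assms(2) by (rule inj_on_subset) auto
    ultimately show ?thesis by (simp add: sum.reindex \<sigma>_eq)
  qed
  show ?thesis
  proof (cases v)
    case (S a)
    have "{e' \<in> cut ?E q. ?l e' = a} = {e' \<in> ?E. e' \<in> cut ?E q \<and> ?l e' = a}"
      "{e \<in> cut E ?p. l e = a} = {e \<in> E. e \<in> cut E ?p \<and> l e = a}"
      using cut_subset[of ?E q] cut_subset[of E ?p] by blast+
    moreover have "(\<Sum>e' \<in> {e' \<in> ?E. e' \<in> cut ?E q \<and> ?l e' = a}. ?\<sigma> e')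
        = (\<Sum>e \<in> {e \<in> E. e \<in> cut E ?p \<and> l e = a}. \<sigma> e)"
      by (rule reindex) (simp add: cut_iff l_eq)
    ultimately show ?thesis by (simp add: S)
  next
    case (T a)
    have "(\<Sum>e' \<in> {e' \<in> ?E. e' \<notin> cut ?E q \<and> ?l e' = a}. ?\<sigma> e')
        = (\<Sum>e \<in> {e \<in> E. e \<notin> cut E ?p \<and> l e = a}. \<sigma> e)"
      by (rule reindex) (simp add: cut_iff l_eq)
    then show ?thesis by (simp add: T)
  qed
qed

text \<open>When \<open>xs\<close> is distinct and contains the entries of \<open>ys\<close>, each
  column is a standard basis vector. Comparing entries instead of positions covers every order of
  the columns, not only the one with the feasible partitions first.\<close>

definition selection_mat :: "'b list \<Rightarrow> 'b list \<Rightarrow> int mat" where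
  "selection_mat xs ys = mat (length xs) (length ys) (\<lambda>(i, j). of_bool (xs ! i = ys ! j))"

lemma toric_mat_mult_selection_mat:
  assumes "distinct ps" "set fs \<subseteq> set ps"
  shows "toric_mat E l \<sigma> rs ps * selection_mat ps fs = toric_mat E l \<sigma> rs fs"
proof (rule eq_matI)
  fix i j
  assume "i < dim_row (toric_mat E l \<sigma> rs fs)" "j < dim_col (toric_mat E l \<sigma> rs fs)"
  then have ij: "i < length rs" "j < length fs" by (auto simp: toric_mat_def)
  then have "fs ! j \<in> set ps" using assms(2) by auto
  then obtain m where m: "m < length ps" "ps ! m = fs ! j" by (auto simp: in_set_conv_nth)
  have "(toric_mat E l \<sigma> rs ps * selection_mat ps fs) $$ (i, j)
      = (\<Sum>h = 0..<length ps. toric_exponent E l \<sigma> (ps ! h) (rs ! i) * of_bool (ps ! h = fs ! j))"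
    using ij by (simp add: toric_mat_def selection_mat_def scalar_prod_def)
  \<comment> \<open>Distinctness of \<open>ps\<close> leaves \<open>m\<close> as the only index with
    a nonzero factor.\<close>
  also have "\<dots> = (\<Sum>h = 0..<length ps. if h = m then toric_exponent E l \<sigma> (ps ! h) (rs ! i) else 0)"
    using m assms(1) by (intro sum.cong) (auto simp: nth_eq_iff_index_eq simp flip: m(2))
  also have "\<dots> = toric_mat E l \<sigma> rs fs $$ (i, j)"
    using m ij by (simp add: toric_mat_def)
  finally show "(toric_mat E l \<sigma> rs ps * selection_mat ps fs) $$ (i, j)
      = toric_mat E l \<sigma> rs fs $$ (i, j)" .
qed (auto simp: toric_mat_def selection_mat_def)

text \<open>Distinctness of \<open>fs\<close> yields the identity block, and disjointness of
  \<open>fs\<close> and \<open>ns\<close> the zero block.\<close>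

lemma selection_mat_append:
  assumes "distinct (fs @ ns)"
  shows "selection_mat (fs @ ns) fs = 1\<^sub>m (length fs) @\<^sub>r 0\<^sub>m (length ns) (length fs)"
proof -
  have "ns ! (i - length fs) \<noteq> fs ! j"
    if "i < length fs + length ns" "\<not> i < length fs" "j < length fs" for i j
  proof -
    have "ns ! (i - length fs) \<in> set ns" "fs ! j \<in> set fs" using that by auto
    with assms show ?thesis by auto
  qed
  with assms show ?thesis
    by (intro eq_matI)
      (auto simp: selection_mat_def append_rows_def nth_append nth_eq_iff_index_eq)
qed

theorem lemma4p1:
  fixes V :: "'v set" and E :: "'v set set" and l :: "'v set \<Rightarrow> 'a" and A :: "'a set"
    and \<sigma> :: "'v set \<Rightarrow> int" and n :: nat and u k :: 'v
    and rs :: "'a toric_var list" and ps qs :: "'v set set list"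
  assumes "labelled_graph V E l A \<sigma>"
    and "card V = n"
    and "u \<in> V" and "k \<in> V" and "u \<noteq> k" and "{u, k} \<notin> E"
    and "simple_collapse u k E"
    and "ordering_of rs (S ` A \<union> T ` A)"
    and "ordering_of ps (partitions V)"
    and "ordering_of qs (partitions (V - {k}))"
  shows "\<exists>\<C> :: int mat set. finite \<C> \<and> \<C> \<noteq> {} \<and>
    (\<forall>C\<in>\<C>.
       C \<in> carrier_mat (2 ^ (n - 1)) (2 ^ (n - 2)) \<and>
       toric_mat E l \<sigma> rs ps * C =
         toric_mat (collapse_edges u k E) (collapse_map u k E l) (collapse_map u k E \<sigma>) rs qs \<and>
       (\<forall>fs ns. ps = fs @ ns \<and>
           set fs = {p \<in> partitions V. feasible u k p} \<and>
           set ns = {p \<in> partitions V. \<not> feasible u k p} \<and>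
           fs = map (feasible_ext u k) qs \<longrightarrow>
         C = 1\<^sub>m (2 ^ (n - 2)) @\<^sub>r 0\<^sub>m (2 ^ (n - 2)) (2 ^ (n - 2))))"
proof -
  let ?fs = "map (feasible_ext u k) qs"
  let ?C = "selection_mat ps ?fs"
  have V: "finite V" and edges: "\<forall>e\<in>E. e \<subseteq> V \<and> card e = 2"
    using assms(1) by (auto simp: labelled_graph_def)
  have "finite E" using V edges by (auto intro: finite_subset[of E "Pow V"])
  \<comment> \<open>On a finite set, an image of equal cardinality forces injectivity.\<close>
  then have inj: "inj_on (collapse_edge u k) E"
    using assms(7) by (simp add: simple_collapse_def collapse_edges_def inj_on_iff_eq_card)
  have ps: "distinct ps" "set ps = partitions V"
    and qs: "distinct qs" "set qs = partitions (V - {k})"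
    using assms(9,10) by (auto simp: ordering_of_def)
  have len_ps: "length ps = 2 ^ (n - 1)"
    using ps V assms(2,3) by (metis card_partitions distinct_card)
  have "card (partitions (V - {k})) = 2 ^ (card (V - {k}) - 1)"
    using V assms(3,5) by (intro card_partitions[of _ u]) auto
  then have len_qs: "length qs = 2 ^ (n - 2)"
    using qs V assms(2,4) by (simp add: numeral_2_eq_2 flip: distinct_card)
  \<comment> \<open>Two distinct vertices give \<open>n \<ge> 2\<close>, so the truncated
    subtractions are genuine and \<open>2 ^ (n - 1)\<close> is twice \<open>2 ^ (n - 2)\<close>.
    Hence both blocks of rows have the same height.\<close>
  have "card {u, k} \<le> n" using V assms(2-4) by (auto intro: card_mono)
  then have n: "n - 1 = Suc (n - 2)" using assms(5) by simp
  have carrier: "?C \<in> carrier_mat (2 ^ (n - 1)) (2 ^ (n - 2))"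
    by (simp add: selection_mat_def len_ps len_qs)
  have "set ?fs \<subseteq> set ps"
    using feasible_ext_in_partitions[OF assms(3-5)] ps qs by auto
  then have "toric_mat E l \<sigma> rs ps * ?C = toric_mat E l \<sigma> rs ?fs"
    using ps(1) by (simp add: toric_mat_mult_selection_mat)
  also have "\<dots> =
      toric_mat (collapse_edges u k E) (collapse_map u k E l) (collapse_map u k E \<sigma>) rs qs"
  proof (rule eq_matI)
    let ?B = "toric_mat (collapse_edges u k E) (collapse_map u k E l) (collapse_map u k E \<sigma>) rs qs"
    fix i j assume "i < dim_row ?B" "j < dim_col ?B"
    then have ij: "i < length rs" "j < length qs" by (auto simp: toric_mat_def)
    then have "qs ! j \<in> partitions (V - {k})" using qs(2) by (metis nth_mem)
    with ij show "toric_mat E l \<sigma> rs ?fs $$ (i, j) = ?B $$ (i, j)"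
      by (simp add: toric_mat_def toric_exponent_collapse[OF edges inj assms(3,5)])
  qed (simp_all add: toric_mat_def)
  finally have product: "toric_mat E l \<sigma> rs ps * ?C =
      toric_mat (collapse_edges u k E) (collapse_map u k E l) (collapse_map u k E \<sigma>) rs qs" .
  have block: "?C = 1\<^sub>m (2 ^ (n - 2)) @\<^sub>r 0\<^sub>m (2 ^ (n - 2)) (2 ^ (n - 2))"
    if "ps = fs @ ns" "fs = ?fs" for fs ns
  proof -
    have "length fs = 2 ^ (n - 2)" "length ns = 2 ^ (n - 2)"
      using that len_ps len_qs n by auto
    with selection_mat_append[of fs ns] ps(1) that show ?thesis by metis
  qed
  show ?thesis
    \<comment> \<open>For fixed orders of the columns a single matrix suffices, so a singleton is
      the finite nonempty set.\<close>
    by (rule exI[of _ "{?C}"]) (use carrier product block in blast)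
qed

end
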